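(* Let $(a_1,\dots,a_n)\in\mathbb{R}^n$ and let $X_1,\dots,X_n$ be mean-zero, pairwise independent real random variables such that in every outcome at most $s$ of them are non-zero, where $s\le n$. Then \[\mathbb{E}\Big[\Big|\sum_i a_iX_i\Big|\Big]\;\ge\;\frac1s\,\mathbb{E}\Big[\sum_i|a_iX_i|\Big].\] *)

theory Defs
  imports "HOL-Probability.Probability"
begin

end

theory Submission
  imports Defs
begin

text \<open>
  Put \<open>Y i = a i * X i\<close>, \<open>S = \<Sum>i. Y i\<close> and \<open>T = \<Sum>i. sgn (Y i)\<close>. At most \<open>s\<close> of the
  \<open>Y i\<close> are non-zero, so \<open>\<bar>T\<bar> \<le> s\<close> and hence \<open>s * E \<bar>S\<bar> \<ge> E (S * T)\<close>. Expanding the product,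
  the off-diagonal terms \<open>E (Y j * sgn (Y i)) = E (Y j) * E (sgn (Y i))\<close> vanish by pairwise
  independence, and the diagonal terms add up to \<open>\<Sum>i. E \<bar>Y i\<bar>\<close>.
\<close>

lemma abs_sum_sgn_le_card:
  fixes f :: "'i \<Rightarrow> real"
  assumes "finite I"
  shows "\<bar>\<Sum>i\<in>I. sgn (f i)\<bar> \<le> real (card {i \<in> I. f i \<noteq> 0})"
proof -
  have "\<bar>\<Sum>i\<in>I. sgn (f i)\<bar> \<le> (\<Sum>i\<in>I. \<bar>sgn (f i)\<bar>)"
    by (rule sum_abs)
  also have "\<dots> = (\<Sum>i\<in>I. if f i \<noteq> 0 then 1 else 0)"
    by (intro sum.cong) (auto simp: sgn_if)
  also have "\<dots> = real (card {i \<in> I. f i \<noteq> 0})"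
    using assms by (simp add: sum.If_cases Int_def)
  finally show ?thesis .
qed

text \<open>Since \<open>sgn\<close> is bounded by 1 in absolute value, \<open>f\<close> itself
  dominates the product.\<close>

lemma integrable_mult_sgn:
  fixes f g :: "'a \<Rightarrow> real"
  assumes "integrable M f" "g \<in> borel_measurable M"
  shows "integrable M (\<lambda>x. f x * sgn (g x))"
  by (rule Bochner_Integration.integrable_bound[OF assms(1)]) (use assms in \<open>auto simp: sgn_if\<close>)

text \<open>The core estimate, with the weights absorbed into \<open>Y\<close> and \<open>s\<close>
  cleared from the denominator, so that \<open>s = 0\<close> needs no special treatment
  here.\<close>

lemma (in prob_space) expectation_abs_sum_ge:
  fixes Y :: "'i \<Rightarrow> 'a \<Rightarrow> real"
  assumes fin: "finite I"
    and int: "\<And>i. i \<in> I \<Longrightarrow> integrable M (Y i)"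
    and mean: "\<And>i. i \<in> I \<Longrightarrow> expectation (Y i) = 0"
    and ind: "pairwise (\<lambda>i j. indep_var borel (Y i) borel (Y j)) I"
    and card: "\<And>\<omega>. \<omega> \<in> space M \<Longrightarrow> card {i \<in> I. Y i \<omega> \<noteq> 0} \<le> s"
  shows "expectation (\<lambda>\<omega>. \<Sum>i\<in>I. \<bar>Y i \<omega>\<bar>) \<le> real s * expectation (\<lambda>\<omega>. \<bar>\<Sum>i\<in>I. Y i \<omega>\<bar>)"
proof -
  have int_sgn: "integrable M (\<lambda>\<omega>. Y j \<omega> * sgn (Y i \<omega>))" if "i \<in> I" "j \<in> I" for i j
    using int that by (intro integrable_mult_sgn) auto
  \<comment> \<open>Off the diagonal the factor \<open>Y j\<close> has mean zero, which is enough: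
    \<open>sgn (Y i)\<close> may have any mean.\<close>
  have cross: "expectation (\<lambda>\<omega>. Y j \<omega> * sgn (Y i \<omega>)) = (if i = j then expectation (\<lambda>\<omega>. \<bar>Y i \<omega>\<bar>) else 0)"
    if ij: "i \<in> I" "j \<in> I" for i j
  proof (cases "i = j")
    case True
    then show ?thesis
      by (simp add: abs_sgn)
  next
    case False
    have "indep_var borel (Y j) borel (Y i)"
      using ind ij False by (auto simp: pairwise_def)
    then have "indep_var borel ((\<lambda>x. x) \<circ> Y j) borel (sgn \<circ> Y i)"
      by (rule indep_var_compose) auto
    then have iv: "indep_var borel (Y j) borel (\<lambda>\<omega>. sgn (Y i \<omega>))"
      by (simp add: comp_def)
    have "integrable M (\<lambda>\<omega>. sgn (Y i \<omega>))"
      \<comment> \<open>Constants are integrable because the measure is finite.\<close>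
      using integrable_mult_sgn[of M "\<lambda>_. 1" "Y i"] int[OF ij(1)] by simp
    from indep_var_lebesgue_integral[OF iv int[OF ij(2)] this] show ?thesis
      using mean[OF ij(2)] False by simp
  qed
  \<comment> \<open>By \<open>cross\<close>, only the term \<open>j = i\<close> survives in each
    inner sum.\<close>
  have "expectation (\<lambda>\<omega>. \<Sum>i\<in>I. \<bar>Y i \<omega>\<bar>) = (\<Sum>i\<in>I. \<Sum>j\<in>I. expectation (\<lambda>\<omega>. Y j \<omega> * sgn (Y i \<omega>)))"
    using fin int by (simp add: cross)
  also have "\<dots> = expectation (\<lambda>\<omega>. \<Sum>i\<in>I. \<Sum>j\<in>I. Y j \<omega> * sgn (Y i \<omega>))"
    by (simp add: int_sgn)
  also have "\<dots> \<le> expectation (\<lambda>\<omega>. real s * \<bar>\<Sum>i\<in>I. Y i \<omega>\<bar>)"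
  proof (rule integral_mono)
    fix \<omega> assume \<omega>: "\<omega> \<in> space M"
    have T: "\<bar>\<Sum>i\<in>I. sgn (Y i \<omega>)\<bar> \<le> real s"
      using abs_sum_sgn_le_card[OF fin, of "\<lambda>i. Y i \<omega>"] card[OF \<omega>] by linarith
    have "(\<Sum>i\<in>I. \<Sum>j\<in>I. Y j \<omega> * sgn (Y i \<omega>)) = (\<Sum>i\<in>I. sgn (Y i \<omega>)) * (\<Sum>j\<in>I. Y j \<omega>)"
      unfolding sum_product by (intro sum.cong refl mult.commute)
    also have "\<dots> \<le> \<bar>\<Sum>i\<in>I. sgn (Y i \<omega>)\<bar> * \<bar>\<Sum>j\<in>I. Y j \<omega>\<bar>"
      by (metis abs_ge_self abs_mult)
    also have "\<dots> \<le> real s * \<bar>\<Sum>j\<in>I. Y j \<omega>\<bar>"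
      using T by (rule mult_right_mono) simp
    finally show "(\<Sum>i\<in>I. \<Sum>j\<in>I. Y j \<omega> * sgn (Y i \<omega>)) \<le> real s * \<bar>\<Sum>i\<in>I. Y i \<omega>\<bar>" .
  qed (use int int_sgn in auto)
  finally show ?thesis
    by simp
qed

theorem theorem1p6:
  fixes M :: "'a measure" and X :: "nat \<Rightarrow> 'a \<Rightarrow> real" and a :: "nat \<Rightarrow> real" and n s :: nat
  assumes "prob_space M"
    and "\<And>i. i \<in> {1..n} \<Longrightarrow> integrable M (X i)"
    and "\<And>i. i \<in> {1..n} \<Longrightarrow> prob_space.expectation M (X i) = 0"
    and "pairwise (\<lambda>i j. prob_space.indep_var M borel (X i) borel (X j)) {1..n}"
    and "\<And>\<omega>. \<omega> \<in> space M \<Longrightarrow> card {i \<in> {1..n}. X i \<omega> \<noteq> 0} \<le> s"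
    and "s \<le> n"
  shows "prob_space.expectation M (\<lambda>\<omega>. \<bar>\<Sum>i=1..n. a i * X i \<omega>\<bar>)
           \<ge> 1 / real s * prob_space.expectation M (\<lambda>\<omega>. \<Sum>i=1..n. \<bar>a i * X i \<omega>\<bar>)"
proof (cases "s = 0")
  \<comment> \<open>Here \<open>1 / real s\<close> is 0 by the convention for division by zero, so
    the claim reduces to nonnegativity of the expectation of an absolute value.\<close>
  case True
  then show ?thesis
    by simp
next
  case False
  interpret prob_space M by fact
  have "expectation (\<lambda>\<omega>. \<Sum>i=1..n. \<bar>a i * X i \<omega>\<bar>) \<le> real s * expectation (\<lambda>\<omega>. \<bar>\<Sum>i=1..n. a i * X i \<omega>\<bar>)"
  proof (rule expectation_abs_sum_ge)
    show "pairwise (\<lambda>i j. indep_var borel (\<lambda>\<omega>. a i * X i \<omega>) borel (\<lambda>\<omega>. a j * X j \<omega>)) {1..n}"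
      using assms(4)
    proof (rule pairwise_mono)
      fix i j assume "indep_var borel (X i) borel (X j)"
      then have "indep_var borel ((\<lambda>x. a i * x) \<circ> X i) borel ((\<lambda>x. a j * x) \<circ> X j)"
        by (rule indep_var_compose) auto
      then show "indep_var borel (\<lambda>\<omega>. a i * X i \<omega>) borel (\<lambda>\<omega>. a j * X j \<omega>)"
        by (simp add: comp_def)
    qed simp
    \<comment> \<open>Weights may be zero, so scaling can only shrink the set of non-zero indices;
      an inclusion suffices for the bound.\<close>
    show "card {i \<in> {1..n}. a i * X i \<omega> \<noteq> 0} \<le> s" if "\<omega> \<in> space M" for \<omega>
      by (rule order_trans[OF card_mono assms(5)[OF that]]) auto
  qed (use assms in auto)
  then show ?thesis
    using False by (simp add: field_simps)
qed

end
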